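(* Let $R$ be a semiring. An ideal $Q$ of $R$ is $k$-semiprime if and only if $Q$ is both a $k$-ideal and a semiprime ideal of $R$.
   Context: A semiring means a commutative semiring with $0$ and $1$: $(R,+,0)$ and $(R,\cdot,1)$ are commutative monoids, $0\cdot x=0$ for all $x$, and $\cdot$ distributes over $+$. An ideal of $R$ is an additive submonoid $I$ with $rx\in I$ for all $r\in R$, $x\in I$; $\langle S\rangle$ is the ideal generated by $S$. A $k$-ideal is an ideal $I$ such that $x, x+y\in I$ implies $y\in I$; a $k$-proper ideal is a $k$-ideal $I\ne R$. The $k$-closure of an ideal $I$ is $\mathcal{C}_k(I)=\{r\in R\mid r+x\in I \text{ for some } x\in I\}$. The product of two $k$-ideals $I,J$ is $IJ=\mathcal{C}_k(\langle\{xy\mid x\in I,y\in J\}\rangle)$, and $I^2=II$. A $k$-proper ideal $P$ is $k$-semiprime if $I^2\subseteq P$ implies $I\subseteq P$ for all $k$-ideals $I$ of $R$. A semiprime ideal is a proper ideal $Q$ such that, for every ideal $I$ of $R$, $I^2\subseteq Q$ implies $I\subseteq Q$, where here $I^2$ is the usual product, i.e. the ideal generated by all $xy$ with $x,y\in I$. *)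

theory Defs
  imports "HOL-Algebra.Ring"
begin

(* HOL-Algebra's ideal and genideal presuppose a ring, and its semiring locale is not commutative,
   so the notions below are set up for commutative semirings.  The zero semiring is allowed. *)

locale csemiring = semiring + comm_monoid R

definition semiring_ideal :: "('a, 'm) ring_scheme \<Rightarrow> 'a set \<Rightarrow> bool" where
  "semiring_ideal R I \<longleftrightarrow>
     submonoid I (add_monoid R) \<and> (\<forall>r\<in>carrier R. \<forall>x\<in>I. r \<otimes>\<^bsub>R\<^esub> x \<in> I)"

definition semiring_genideal :: "('a, 'm) ring_scheme \<Rightarrow> 'a set \<Rightarrow> 'a set" where
  "semiring_genideal R S = \<Inter>{I. semiring_ideal R I \<and> S \<subseteq> I}"

definition ideal_mult :: "('a, 'm) ring_scheme \<Rightarrow> 'a set \<Rightarrow> 'a set \<Rightarrow> 'a set" where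
  "ideal_mult R I J = semiring_genideal R {x \<otimes>\<^bsub>R\<^esub> y | x y. x \<in> I \<and> y \<in> J}"

definition k_ideal :: "('a, 'm) ring_scheme \<Rightarrow> 'a set \<Rightarrow> bool" where
  "k_ideal R I \<longleftrightarrow> semiring_ideal R I \<and>
     (\<forall>x\<in>carrier R. \<forall>y\<in>carrier R. x \<in> I \<and> x \<oplus>\<^bsub>R\<^esub> y \<in> I \<longrightarrow> y \<in> I)"

definition k_proper_ideal :: "('a, 'm) ring_scheme \<Rightarrow> 'a set \<Rightarrow> bool" where
  "k_proper_ideal R I \<longleftrightarrow> k_ideal R I \<and> I \<noteq> carrier R"

definition k_closure :: "('a, 'm) ring_scheme \<Rightarrow> 'a set \<Rightarrow> 'a set" where
  "k_closure R I = {r \<in> carrier R. \<exists>x\<in>I. r \<oplus>\<^bsub>R\<^esub> x \<in> I}"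

definition k_ideal_mult :: "('a, 'm) ring_scheme \<Rightarrow> 'a set \<Rightarrow> 'a set \<Rightarrow> 'a set" where
  "k_ideal_mult R I J =
     k_closure R (semiring_genideal R {x \<otimes>\<^bsub>R\<^esub> y | x y. x \<in> I \<and> y \<in> J})"

definition k_semiprime :: "('a, 'm) ring_scheme \<Rightarrow> 'a set \<Rightarrow> bool" where
  "k_semiprime R P \<longleftrightarrow> k_proper_ideal R P \<and>
     (\<forall>I. k_ideal R I \<longrightarrow> k_ideal_mult R I I \<subseteq> P \<longrightarrow> I \<subseteq> P)"

definition semiprime_ideal :: "('a, 'm) ring_scheme \<Rightarrow> 'a set \<Rightarrow> bool" where
  "semiprime_ideal R Q \<longleftrightarrow> semiring_ideal R Q \<and> Q \<noteq> carrier R \<and>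
     (\<forall>I. semiring_ideal R I \<longrightarrow> ideal_mult R I I \<subseteq> Q \<longrightarrow> I \<subseteq> Q)"

end

theory Submission
  imports Defs
begin

(* If Q is a k-ideal containing I^2, then cancelling in Q one factor at a time shows that Q contains
   all products of elements of the k-closure J of I.  Hence the k-product of J with itself lies in Q,
   and k-semiprimeness gives that I, being contained in J, lies in Q. *)

context csemiring
begin

lemma semiring_ideal_iff:
  "semiring_ideal R I \<longleftrightarrow> I \<subseteq> carrier R \<and> \<zero> \<in> I \<and> (\<forall>x\<in>I. \<forall>y\<in>I. x \<oplus> y \<in> I)
     \<and> (\<forall>r\<in>carrier R. \<forall>x\<in>I. r \<otimes> x \<in> I)"
  by (auto simp: semiring_ideal_def submonoid_def)

lemma semiring_ideal_carrier: "semiring_ideal R (carrier R)"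
  by (simp add: semiring_ideal_iff)

lemma semiring_genideal_minimal:
  "semiring_ideal R I \<Longrightarrow> S \<subseteq> I \<Longrightarrow> semiring_genideal R S \<subseteq> I"
  by (auto simp: semiring_genideal_def)

lemma semiring_genideal_incl: "S \<subseteq> semiring_genideal R S"
  by (auto simp: semiring_genideal_def)

lemma zero_mem_semiring_genideal: "\<zero> \<in> semiring_genideal R S"
  by (auto simp: semiring_genideal_def semiring_ideal_iff)

lemma k_closureI: "r \<in> carrier R \<Longrightarrow> x \<in> I \<Longrightarrow> r \<oplus> x \<in> I \<Longrightarrow> r \<in> k_closure R I"
  by (auto simp: k_closure_def)

text \<open>The witness is \<open>\<zero>\<close>, because
  \<open>r \<oplus> \<zero> = r\<close>.\<close>

lemma subset_k_closure:
  assumes "I \<subseteq> carrier R" "\<zero> \<in> I"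
  shows "I \<subseteq> k_closure R I"
  using assms by (force simp: k_closure_def)

text \<open>If \<open>x\<close> and \<open>r \<oplus> x\<close> lie in \<open>I\<close>, they lie in
  \<open>K\<close>, and cancelling \<open>x\<close> there leaves \<open>r\<close>. Commutativity
  turns the sum round, since \<open>k_ideal\<close> cancels the left summand.\<close>

lemma k_closure_minimal:
  assumes "k_ideal R K" "I \<subseteq> K"
  shows "k_closure R I \<subseteq> K"
proof
  fix r assume "r \<in> k_closure R I"
  then obtain x where x: "r \<in> carrier R" "x \<in> I" "r \<oplus> x \<in> I"
    by (auto simp: k_closure_def)
  moreover have "x \<in> carrier R"
    using assms x(2) by (auto simp: k_ideal_def semiring_ideal_iff)
  ultimately show "r \<in> K"
    using assms by (metis a_comm k_ideal_def subsetD)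
qed

text \<open>Supplies a k-ideal to test k-semiprimeness on when \<open>I\<close> is merely an ideal.
  Each closure property follows by combining the witnesses of the given elements.\<close>

lemma k_ideal_k_closure:
  assumes I: "semiring_ideal R I"
  shows "k_ideal R (k_closure R I)"
proof -
  have sub: "\<And>x. x \<in> I \<Longrightarrow> x \<in> carrier R" and zero: "\<zero> \<in> I"
    and add: "\<And>x y. x \<in> I \<Longrightarrow> y \<in> I \<Longrightarrow> x \<oplus> y \<in> I"
    and mult: "\<And>r x. r \<in> carrier R \<Longrightarrow> x \<in> I \<Longrightarrow> r \<otimes> x \<in> I"
    using I by (auto simp: semiring_ideal_iff)
  have "a \<oplus> b \<in> k_closure R I"
    if ab: "a \<in> k_closure R I" "b \<in> k_closure R I" for a b
  proof -
    obtain x y where xy: "x \<in> I" "a \<oplus> x \<in> I" "y \<in> I" "b \<oplus> y \<in> I" and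
      car: "a \<in> carrier R" "b \<in> carrier R"
      using ab by (auto simp: k_closure_def)
    have "(a \<oplus> b) \<oplus> (x \<oplus> y) = (a \<oplus> x) \<oplus> (b \<oplus> y)"
      using car xy sub by (simp add: a_ac)
    then have "(a \<oplus> b) \<oplus> (x \<oplus> y) \<in> I"
      using add xy by simp
    then show ?thesis
      by (rule k_closureI[rotated 2]) (use car xy add in simp_all)
  qed
  moreover have "r \<otimes> a \<in> k_closure R I"
    if r: "r \<in> carrier R" and a: "a \<in> k_closure R I" for r a
  proof -
    obtain x where x: "x \<in> I" "a \<oplus> x \<in> I" and car: "a \<in> carrier R"
      using a by (auto simp: k_closure_def)
    have "r \<otimes> a \<oplus> r \<otimes> x = r \<otimes> (a \<oplus> x)"
      using r car x sub by (simp add: r_distr)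
    then have "r \<otimes> a \<oplus> r \<otimes> x \<in> I" "r \<otimes> x \<in> I"
      using mult r x by auto
    then show ?thesis
      using r car by (intro k_closureI[of "r \<otimes> a" "r \<otimes> x"]) simp_all
  qed
  moreover have "b \<in> k_closure R I"
    if a: "a \<in> k_closure R I" and s: "a \<oplus> b \<in> k_closure R I" and b: "b \<in> carrier R" for a b
  proof -
    obtain x y where xy: "x \<in> I" "a \<oplus> x \<in> I" "y \<in> I" "a \<oplus> b \<oplus> y \<in> I"
      and car: "a \<in> carrier R"
      using a s by (auto simp: k_closure_def)
    \<comment> \<open>The witness for \<open>b\<close> is \<open>a \<oplus> x \<oplus> y\<close>, a
      sum of the elements \<open>a \<oplus> x\<close> and \<open>y\<close> of \<open>I\<close>.
      Adding \<open>b\<close> and regrouping gives again a sum of two elements of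
      \<open>I\<close>.\<close>
    have "b \<oplus> (a \<oplus> x \<oplus> y) = (a \<oplus> b \<oplus> y) \<oplus> x"
      using car b xy sub by (simp add: a_ac)
    then have "b \<oplus> (a \<oplus> x \<oplus> y) \<in> I"
      using add xy by simp
    then show ?thesis
      by (rule k_closureI[rotated 2]) (use b xy add in simp_all)
  qed
  moreover have "k_closure R I \<subseteq> carrier R"
    by (auto simp: k_closure_def)
  moreover have "\<zero> \<in> k_closure R I"
    using subset_k_closure[of I] sub zero by auto
  ultimately show ?thesis
    unfolding k_ideal_def semiring_ideal_iff by blast
qed

text \<open>The k-product is the k-closure of the ordinary product, and a set containing zero inside
  the carrier lies in its k-closure.\<close>

lemma ideal_mult_subset_k_ideal_mult:
  assumes "semiring_ideal R I" "semiring_ideal R J"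
  shows "ideal_mult R I J \<subseteq> k_ideal_mult R I J"
  unfolding ideal_mult_def k_ideal_mult_def
proof (rule subset_k_closure[OF _ zero_mem_semiring_genideal])
  \<comment> \<open>The carrier is itself an ideal containing all these products. For generators
    outside the carrier the family intersected would be empty and the result
    \<open>UNIV\<close>.\<close>
  show "semiring_genideal R {x \<otimes> y |x y. x \<in> I \<and> y \<in> J} \<subseteq> carrier R"
    using assms
    by (intro semiring_genideal_minimal semiring_ideal_carrier) (auto simp: semiring_ideal_iff)
qed

text \<open>By distributivity \<open>(a \<oplus> x) \<otimes> z\<close> is
  \<open>x \<otimes> z \<oplus> a \<otimes> z\<close>, and the first summand cancels in
  \<open>K\<close>.\<close>

lemma k_ideal_cancel:
  assumes "k_ideal R K" "a \<in> carrier R" "x \<in> carrier R" "z \<in> carrier R"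
    and "x \<otimes> z \<in> K" "(a \<oplus> x) \<otimes> z \<in> K"
  shows "a \<otimes> z \<in> K"
proof -
  have "x \<otimes> z \<oplus> a \<otimes> z \<in> K"
    using assms by (simp add: l_distr a_comm)
  then show ?thesis
    using assms unfolding k_ideal_def by blast
qed

lemma k_ideal_mult_k_closure_subset:
  assumes I: "semiring_ideal R I" and J: "semiring_ideal R J"
    and K: "k_ideal R K" and IJ: "ideal_mult R I J \<subseteq> K"
  shows "k_ideal_mult R (k_closure R I) (k_closure R J) \<subseteq> K"
proof -
  have "{x \<otimes> y |x y. x \<in> I \<and> y \<in> J} \<subseteq> K"
    using IJ semiring_genideal_incl unfolding ideal_mult_def by (rule subset_trans[rotated])
  then have prod: "x \<otimes> y \<in> K" if "x \<in> I" "y \<in> J" for x y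
    using that by blast
  have sub: "I \<subseteq> carrier R" "J \<subseteq> carrier R"
    using I J by (auto simp: semiring_ideal_iff)
  \<comment> \<open>First pass: only the left factor moves to the closure. Both \<open>x\<close> and
    \<open>a \<oplus> x\<close> lie in \<open>I\<close>, so their products with \<open>z\<close> are
    already in \<open>K\<close>.\<close>
  have left: "a \<otimes> z \<in> K" if a: "a \<in> k_closure R I" and z: "z \<in> J" for a z
  proof -
    obtain x where "x \<in> I" "a \<oplus> x \<in> I" "a \<in> carrier R"
      using a by (auto simp: k_closure_def)
    then show ?thesis
      using k_ideal_cancel[OF K, of a x z] prod z sub by auto
  qed
  have "a \<otimes> b \<in> K" if a: "a \<in> k_closure R I" and b: "b \<in> k_closure R J" for a b
  proof -
    obtain y where y: "y \<in> J" "b \<oplus> y \<in> J" "b \<in> carrier R"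
      using b by (auto simp: k_closure_def)
    have ca: "a \<in> carrier R"
      using a by (simp add: k_closure_def)
    \<comment> \<open>Second pass: \<open>y\<close> and \<open>b \<oplus> y\<close> lie in
      \<open>J\<close>, so \<open>left\<close> covers their products with \<open>a\<close>. The
      factors are swapped because \<open>k_ideal_cancel\<close> acts on the left one.\<close>
    have "y \<otimes> a \<in> K" "(b \<oplus> y) \<otimes> a \<in> K"
      using left[OF a y(1)] left[OF a y(2)] y ca sub by (auto simp: m_comm)
    then have "b \<otimes> a \<in> K"
      using k_ideal_cancel[OF K] y ca sub by blast
    then show ?thesis
      using y ca by (simp add: m_comm)
  qed
  then have "{a \<otimes> b |a b. a \<in> k_closure R I \<and> b \<in> k_closure R J} \<subseteq> K"
    by blast
  moreover have "semiring_ideal R K"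
    using K by (simp add: k_ideal_def)
  ultimately show ?thesis
    unfolding k_ideal_mult_def by (intro k_closure_minimal[OF K] semiring_genideal_minimal)
qed

lemma k_semiprime_iff: "k_semiprime R Q \<longleftrightarrow> k_ideal R Q \<and> semiprime_ideal R Q"
proof
  assume Q: "k_semiprime R Q"
  then have k: "k_ideal R Q"
    by (simp add: k_semiprime_def k_proper_ideal_def)
  have "I \<subseteq> Q" if I: "semiring_ideal R I" and sq: "ideal_mult R I I \<subseteq> Q" for I
  proof -
    have "k_closure R I \<subseteq> Q"
      using Q k_ideal_k_closure[OF I] k_ideal_mult_k_closure_subset[OF I I k sq]
      by (simp add: k_semiprime_def)
    moreover have "I \<subseteq> k_closure R I"
      using I by (intro subset_k_closure) (auto simp: semiring_ideal_iff)
    ultimately show ?thesis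
      by blast
  qed
  then show "k_ideal R Q \<and> semiprime_ideal R Q"
    using Q k unfolding semiprime_ideal_def k_semiprime_def k_proper_ideal_def k_ideal_def by blast
next
  assume Q: "k_ideal R Q \<and> semiprime_ideal R Q"
  \<comment> \<open>For the converse no closure of \<open>I\<close> is taken: a k-ideal is an ideal,
    and its ordinary square lies in its k-square, so semiprimeness of \<open>Q\<close> applies to
    \<open>I\<close> itself.\<close>
  have "I \<subseteq> Q" if I: "k_ideal R I" and sq: "k_ideal_mult R I I \<subseteq> Q" for I
  proof -
    have "semiring_ideal R I"
      using I by (simp add: k_ideal_def)
    moreover from this have "ideal_mult R I I \<subseteq> Q"
      using ideal_mult_subset_k_ideal_mult sq by (meson subset_trans)
    ultimately show ?thesis
      using Q by (simp add: semiprime_ideal_def)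
  qed
  then show "k_semiprime R Q"
    using Q unfolding k_semiprime_def k_proper_ideal_def semiprime_ideal_def by blast
qed

end

theorem proposition3p11:
  fixes R :: "('a, 'm) ring_scheme" and Q :: "'a set"
  assumes "csemiring R"
    and "semiring_ideal R Q"
  shows "k_semiprime R Q \<longleftrightarrow> k_ideal R Q \<and> semiprime_ideal R Q"
  using assms(1) by (rule csemiring.k_semiprime_iff)

end
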